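(* Let $q$ be a prime power, and let $\mathrm{AG}(3,q)$ be the affine space obtained from $\mathrm{PG}(3,q)$ by removing the plane at infinity $\pi_\infty$. If $\mathcal{L}$ is a Cameron-Liebler line class of parameter $x$ in $\mathrm{AG}(3,q)$, then $\mathcal{L}$ (its lines being regarded as lines of $\mathrm{PG}(3,q)$) is a Cameron-Liebler line class in $\mathrm{PG}(3,q)$ with the same parameter $x$.
   Context: $\mathrm{PG}(3,q)$ and $\mathrm{AG}(3,q)$ are the 3-dimensional projective and affine spaces over $\mathbb{F}_q$. $\mathrm{AG}(3,q)$ is obtained from $\mathrm{PG}(3,q)$ by removing a fixed plane $\pi_\infty$ (the plane at infinity); lines of $\mathrm{AG}(3,q)$ are identified with the lines of $\mathrm{PG}(3,q)$ not contained in $\pi_\infty$. A line spread of $\mathrm{PG}(3,q)$ (resp. $\mathrm{AG}(3,q)$) is a set of pairwise disjoint lines of that space that partitions the points of that space. A Cameron-Liebler line class of parameter $x$ in $\mathrm{PG}(3,q)$ (resp. $\mathrm{AG}(3,q)$) is a set $\mathcal{L}$ of lines of that space such that $|\mathcal{L}\cap\mathcal{S}|=x$ for every line spread $\mathcal{S}$ of that space. *)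

theory Defs
  imports "HOL-Analysis.Cartesian_Space" "HOL-Library.Disjoint_Sets"
begin

text \<open>
  The type \<open>'a\<close> plays the role of the field with \<open>q\<close> elements, \<open>q = CARD('a)\<close>; the order of a
  finite field is automatically a prime power.  Lines and planes are represented by their sets of
  points.
\<close>

definition pg_points :: "('a::field ^ 4) set set" where
  "pg_points = {P. vec.subspace P \<and> vec.dim P = 1}"

definition pg_points_in :: "('a::field ^ 4) set \<Rightarrow> ('a ^ 4) set set" where
  "pg_points_in U = {P \<in> pg_points. P \<subseteq> U}"

definition pg_lines :: "('a::field ^ 4) set set set" where
  "pg_lines = {pg_points_in U | U. vec.subspace U \<and> vec.dim U = 2}"

definition pg_planes :: "('a::field ^ 4) set set set" where
  "pg_planes = {pg_points_in U | U. vec.subspace U \<and> vec.dim U = 3}"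

definition ag_points :: "('a::field ^ 4) set set \<Rightarrow> ('a ^ 4) set set" where
  "ag_points \<pi> = pg_points - \<pi>"

text \<open>An affine line is identified with its projective completion, so it still contains its point
  at infinity as a set.\<close>

definition ag_lines :: "('a::field ^ 4) set set \<Rightarrow> ('a ^ 4) set set set" where
  "ag_lines \<pi> = {l \<in> pg_lines. \<not> l \<subseteq> \<pi>}"

text \<open>
  The next two definitions apply to any space given by its points \<open>Pts\<close> and its lines \<open>Lns\<close>.  Only
  the points of the space itself count for disjointness and covering: affine lines may share a
  point at infinity and still be disjoint.  In the projective space, \<open>l \<inter> Pts = l\<close>.
\<close>

definition line_spread :: "'p set \<Rightarrow> 'p set set \<Rightarrow> 'p set set \<Rightarrow> bool" where
  "line_spread Pts Lns S \<longleftrightarrow>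
     S \<subseteq> Lns \<and> disjoint_family_on (\<lambda>l. l \<inter> Pts) S \<and> (\<Union>l\<in>S. l \<inter> Pts) = Pts"

definition cameron_liebler :: "'p set \<Rightarrow> 'p set set \<Rightarrow> nat \<Rightarrow> 'p set set \<Rightarrow> bool" where
  "cameron_liebler Pts Lns x L \<longleftrightarrow>
     L \<subseteq> Lns \<and> (\<forall>S. line_spread Pts Lns S \<longrightarrow> card (L \<inter> S) = x)"

end

theory Submission
  imports Defs
begin

text \<open>The lines of a projective spread \<open>S\<close> that are not inside \<pi> form an
  affine spread (\<open>line_spread_ag_lines\<close>). An affine Cameron-Liebler class
  \<open>L\<close> consists of such lines only, so it meets \<open>S\<close> and this affine spread
  in the same set of lines, which has \<open>x\<close> elements.\<close>

text \<open>Discarding the lines at infinity from a projective spread leaves an affine spread, and no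
  line of \<open>L\<close> is discarded.\<close>

lemma line_spread_ag_lines:
  assumes "line_spread pg_points pg_lines S"
  shows "line_spread (ag_points \<pi>) (ag_lines \<pi>) (S \<inter> ag_lines \<pi>)"
proof -
  have S: "S \<subseteq> pg_lines" and disj: "disjoint_family_on (\<lambda>l. l \<inter> pg_points) S"
    and cover: "(\<Union>l\<in>S. l \<inter> pg_points) = pg_points"
    using assms by (auto simp: line_spread_def)
  \<comment> \<open>Lines without a common projective point have no common affine point.\<close>
  have "disjoint_family_on (\<lambda>l. l \<inter> ag_points \<pi>) (S \<inter> ag_lines \<pi>)"
    using disj unfolding disjoint_family_on_def ag_points_def by blast
  moreover have "(\<Union>l\<in>S \<inter> ag_lines \<pi>. l \<inter> ag_points \<pi>) = ag_points \<pi>"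
  proof (intro equalityI subsetI)
    fix P assume P: "P \<in> ag_points \<pi>"
    then obtain l where "l \<in> S" "P \<in> l"
      using cover unfolding ag_points_def by blast
    \<comment> \<open>As \<open>P\<close> lies on \<open>l\<close> but not in \<pi>, the line
      \<open>l\<close> is not inside \<pi> and is kept.\<close>
    with P S show "P \<in> (\<Union>l\<in>S \<inter> ag_lines \<pi>. l \<inter> ag_points \<pi>)"
      unfolding ag_points_def ag_lines_def by blast
  qed blast
  ultimately show ?thesis
    by (simp add: line_spread_def)
qed

theorem theorem3p2:
  fixes \<pi> :: "('a::{field,finite} ^ 4) set set"
    and L :: "('a ^ 4) set set set"
    and x :: nat
  assumes "\<pi> \<in> pg_planes"
    and "cameron_liebler (ag_points \<pi>) (ag_lines \<pi>) x L"
  shows "cameron_liebler pg_points pg_lines x L"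
proof -
  have L: "L \<subseteq> ag_lines \<pi>"
    and x: "\<And>S. line_spread (ag_points \<pi>) (ag_lines \<pi>) S \<Longrightarrow> card (L \<inter> S) = x"
    using assms(2) by (auto simp: cameron_liebler_def)
  have "card (L \<inter> S) = x" if "line_spread pg_points pg_lines S" for S
  proof -
    have "L \<inter> S = L \<inter> (S \<inter> ag_lines \<pi>)"
      using L by blast
    then show ?thesis
      using x[OF line_spread_ag_lines[OF that]] by simp
  qed
  moreover have "L \<subseteq> pg_lines"
    using L by (auto simp: ag_lines_def)
  ultimately show ?thesis
    by (simp add: cameron_liebler_def)
qed

end
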